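(* Let $n\ge1$, let $\lambda,\beta\in R$, and let $(a_{i,j})_{1\le i,j\le n}$ be a doubly indexed family of elements of $R$ such that $a_{i,1}=\beta a_{1,i}$ for all $i>1$. Let $A=(A_{i,j})_{1\le i,j\le n}$ be the $n\times n$ matrix with $$A_{i,j}=\begin{cases}\lambda a_{1,j} & \text{if } 1=i\ne j,\\ a_{i,j} & \text{otherwise.}\end{cases}$$ Furthermore, define two $(n-1)\times(n-1)$ matrices $B=(B_{i,j})_{2\le i,j\le n}$ and $C=(C_{i,j})_{2\le i,j\le n}$ by $$B_{i,j}=\begin{cases}a_{i,j}-\lambda a_{1,i}a_{1,j} & \text{if } i+j \text{ is even},\\ a_{i,j} & \text{if } i+j \text{ is odd},\end{cases}\qquad C_{i,j}=\begin{cases}a_{i,j} & \text{if } i+j \text{ is even},\\ a_{i,j}-\lambda a_{1,i}a_{1,j} & \text{if } i+j \text{ is odd}.\end{cases}$$ Then $$\det A-\beta(\det B+\det C)=(a_{1,1}-2\beta)\det(a_{i,j})_{2\le i,j\le n}.$$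
   Context: $R$ is a commutative ring containing $\mathbb{Q}$; in the paper the $a_{i,j}$, $\lambda$, $\beta$ are thought of as indeterminates (subject to the stated relations). The determinant of an empty matrix is $1$. *)

theory Defs
  imports "Jordan_Normal_Form.Determinant"
begin

text \<open>
  The type \<^typ>\<open>'a mat\<close> is indexed from 0.  The square matrix below has
  rows and columns labelled \<open>lo, \<dots>, hi\<close>, so its entry at position \<open>(i, j)\<close>
  is \<open>f (lo + i) (lo + j)\<close>; the matrix is empty if \<open>hi < lo\<close>.
\<close>

definition labelled_mat :: "nat \<Rightarrow> nat \<Rightarrow> (nat \<Rightarrow> nat \<Rightarrow> 'a) \<Rightarrow> 'a mat" where
  "labelled_mat lo hi f =
     mat (Suc hi - lo) (Suc hi - lo) (\<lambda>(i, j). f (lo + i) (lo + j))"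

definition A_mat :: "nat \<Rightarrow> 'a::comm_ring_1 \<Rightarrow> (nat \<Rightarrow> nat \<Rightarrow> 'a) \<Rightarrow> 'a mat" where
  "A_mat n lam a = labelled_mat 1 n
     (\<lambda>i j. if 1 = i \<and> i \<noteq> j then lam * a 1 j else a i j)"

definition B_mat :: "nat \<Rightarrow> 'a::comm_ring_1 \<Rightarrow> (nat \<Rightarrow> nat \<Rightarrow> 'a) \<Rightarrow> 'a mat" where
  "B_mat n lam a = labelled_mat 2 n
     (\<lambda>i j. if even (i + j) then a i j - lam * a 1 i * a 1 j else a i j)"

definition C_mat :: "nat \<Rightarrow> 'a::comm_ring_1 \<Rightarrow> (nat \<Rightarrow> nat \<Rightarrow> 'a) \<Rightarrow> 'a mat" where
  "C_mat n lam a = labelled_mat 2 n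
     (\<lambda>i j. if even (i + j) then a i j else a i j - lam * a 1 i * a 1 j)"

end

theory Submission
  imports Defs
begin

text \<open>
  Write \<open>v\<close> for the vector \<open>(a\<^bsub>1,2\<^esub>, \<dots>, a\<^bsub>1,n\<^esub>)\<close>, \<open>d\<close> for \<open>v\<close> with alternating signs, and
  \<open>M\<close> for \<open>(a\<^bsub>i,j\<^esub>)\<close> with \<open>i, j \<ge> 2\<close>.  Since \<open>1 + (-1)\<^bsup>i+j\<^esup>\<close> is \<open>2\<close> or \<open>0\<close> according to the
  parity of \<open>i + j\<close>, halving \<open>\<lambda>\<close> turns the parity conditions into two rank-one updates:
  \<open>B = N - (\<lambda>/2) d d\<^sup>T\<close> and \<open>C = N + (\<lambda>/2) d d\<^sup>T\<close>, where \<open>N = M - (\<lambda>/2) v v\<^sup>T\<close>.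

  The determinant is affine along a rank-one direction (\<open>det_rank_one_update\<close>), so the
  contributions of \<open>d\<close> to \<open>det B\<close> and \<open>det C\<close> cancel and \<open>det B + det C = 2 det N\<close>, which equals
  \<open>2 det M + \<lambda> E\<close>; here \<open>E\<close> is the determinant of \<open>M\<close> bordered by \<open>v\<close> on both sides
  and \<open>0\<close> in the corner.  The matrix \<open>A\<close> is also a bordered matrix, with corner \<open>a\<^bsub>1,1\<^esub>\<close>, border
  row \<open>\<lambda> v\<close> and border column \<open>\<beta> v\<close>, so \<open>det A = a\<^bsub>1,1\<^esub> det M + \<lambda> \<beta> E\<close> (\<open>det_bordered_scaled\<close>).
  Subtracting \<open>\<beta> (2 det M + \<lambda> E)\<close> eliminates \<open>E\<close>.
\<close>

definition bordered_mat ::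
  "nat \<Rightarrow> 'a \<Rightarrow> (nat \<Rightarrow> 'a) \<Rightarrow> (nat \<Rightarrow> 'a) \<Rightarrow> (nat \<Rightarrow> nat \<Rightarrow> 'a) \<Rightarrow> 'a mat" where
  "bordered_mat m c x y M = mat (Suc m) (Suc m)
     (\<lambda>(i, j). case i of
        0 \<Rightarrow> (case j of 0 \<Rightarrow> c | Suc j' \<Rightarrow> y j')
      | Suc i' \<Rightarrow> (case j of 0 \<Rightarrow> x i' | Suc j' \<Rightarrow> M i' j'))"

lemma bordered_mat_carrier [simp]:
  "bordered_mat m c x y M \<in> carrier_mat (Suc m) (Suc m)"
  by (simp add: bordered_mat_def)

text \<open>
  In the Laplace expansion along the first row the cofactors do not involve that row, so the
  determinant is linear in the corner and the border row together.
\<close>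

lemma det_bordered_row_scaled:
  fixes c s :: "'a::comm_ring_1"
  shows "det (bordered_mat m c x (\<lambda>j. s * y j) M) =
    c * det (mat m m (\<lambda>(i, j). M i j)) + s * det (bordered_mat m 0 x y M)"
proof -
  have del: "mat_delete (bordered_mat m c x z M) 0 j
      = mat_delete (bordered_mat m 0 x y M) 0 j" for c z j
    by (rule eq_matI) (auto simp: mat_delete_def bordered_mat_def)
  have del00: "mat_delete (bordered_mat m 0 x y M) 0 0 = mat m m (\<lambda>(i, j). M i j)"
    by (rule eq_matI) (auto simp: mat_delete_def bordered_mat_def)
  have expand: "det (bordered_mat m c x z M) = c * det (mat m m (\<lambda>(i, j). M i j))
      + (\<Sum>j<m. z j * cofactor (bordered_mat m 0 x y M) 0 (Suc j))" for c z
  proof -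
    have "det (bordered_mat m c x z M) = (\<Sum>j<Suc m. bordered_mat m c x z M $$ (0, j)
        * cofactor (bordered_mat m c x z M) 0 j)"
      by (rule laplace_expansion_row) simp_all
    also have "\<dots> = (\<Sum>j<Suc m. bordered_mat m c x z M $$ (0, j)
        * cofactor (bordered_mat m 0 x y M) 0 j)"
      by (simp only: cofactor_def del[of c z])
    also have "\<dots> = c * cofactor (bordered_mat m 0 x y M) 0 0
        + (\<Sum>j<m. z j * cofactor (bordered_mat m 0 x y M) 0 (Suc j))"
      by (subst sum.lessThan_Suc_shift) (simp add: bordered_mat_def)
    finally show ?thesis by (simp add: cofactor_def del00)
  qed
  show ?thesis
    by (simp add: expand sum_distrib_left mult.assoc)
qed

lemma det_bordered_swap:
  fixes c :: "'a::comm_ring_1"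
  shows "det (bordered_mat m c x y M) = det (bordered_mat m c y x (\<lambda>i j. M j i))"
proof -
  have "transpose_mat (bordered_mat m c y x (\<lambda>i j. M j i)) = bordered_mat m c x y M"
    by (rule eq_matI) (auto simp: bordered_mat_def split: nat.splits)
  then show ?thesis
    using det_transpose[OF bordered_mat_carrier, of m c y x "\<lambda>i j. M j i"] by simp
qed

lemma det_bordered_scaled:
  fixes c s b :: "'a::comm_ring_1"
  shows "det (bordered_mat m c (\<lambda>i. b * x i) (\<lambda>j. s * y j) M) =
    c * det (mat m m (\<lambda>(i, j). M i j)) + s * b * det (bordered_mat m 0 x y M)"
proof -
  have "det (bordered_mat m 0 (\<lambda>i. b * x i) y M) = b * det (bordered_mat m 0 x y M)"
    by (simp add: det_bordered_swap[of m _ "\<lambda>i. b * x i" y] det_bordered_swap[of m _ x y]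
        det_bordered_row_scaled)
  then show ?thesis
    by (simp add: det_bordered_row_scaled mult.assoc)
qed

text \<open>
  A form of the matrix determinant lemma that avoids the adjugate.  Adding multiples of the first
  row clears the border column of a bordered matrix with corner \<open>1\<close>; this leaves the rank-one
  update of \<open>M\<close> in the lower block.
\<close>

lemma det_rank_one_update:
  fixes t :: "'a::comm_ring_1"
  shows "det (mat m m (\<lambda>(i, j). M i j + t * x i * y j)) =
    det (mat m m (\<lambda>(i, j). M i j)) - t * det (bordered_mat m 0 x y M)"
proof -
  let ?M' = "\<lambda>i j. M i j + t * x i * y j"
  let ?L = "bordered_mat m 1 x (\<lambda>j. 0) (\<lambda>i j. if i = j then 1 else 0)"
  let ?U = "bordered_mat m 1 (\<lambda>i. 0) (\<lambda>j. - t * y j) ?M'"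
  \<comment> \<open>The unitriangular factor on the left undoes the elimination.\<close>
  have factor: "bordered_mat m 1 x (\<lambda>j. - t * y j) M = ?L * ?U"
  proof (rule eq_matI)
    fix i j assume "i < dim_row (?L * ?U)" "j < dim_col (?L * ?U)"
    then have ij: "i < Suc m" "j < Suc m" by (simp_all add: bordered_mat_def)
    have "(?L * ?U) $$ (i, j) = (\<Sum>k<Suc m. ?L $$ (i, k) * ?U $$ (k, j))"
      using ij by (simp add: bordered_mat_def scalar_prod_def lessThan_atLeast0)
    also have "\<dots> = ?L $$ (i, 0) * ?U $$ (0, j) + (\<Sum>k<m. ?L $$ (i, Suc k) * ?U $$ (Suc k, j))"
      by (rule sum.lessThan_Suc_shift)
    also have "\<dots> = bordered_mat m 1 x (\<lambda>j. - t * y j) M $$ (i, j)"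
      using ij by (auto simp: bordered_mat_def if_distrib[of "\<lambda>z. z * _"] algebra_simps
          cong: if_cong split: nat.splits)
    finally show "bordered_mat m 1 x (\<lambda>j. - t * y j) M $$ (i, j) = (?L * ?U) $$ (i, j)"
      by simp
  qed (simp_all add: bordered_mat_def)
  have "mat m m (\<lambda>(i, j). if i = j then 1 else 0 :: 'a) = 1\<^sub>m m"
    by (rule eq_matI) auto
  then have detL: "det ?L = 1"
    using det_bordered_row_scaled[of m 1 x 0 "\<lambda>j. 0"] by simp
  have detU: "det ?U = det (mat m m (\<lambda>(i, j). ?M' i j))"
    using det_bordered_scaled[of m 1 0 "\<lambda>i. 0" "- t" y ?M'] by simp
  have "det (bordered_mat m 1 x (\<lambda>j. - t * y j) M) = det (mat m m (\<lambda>(i, j). ?M' i j))"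
    unfolding factor by (subst det_mult[OF bordered_mat_carrier bordered_mat_carrier])
      (simp only: detL detU mult_1)
  then show ?thesis
    using det_bordered_row_scaled[of m 1 x "- t" y M] by simp
qed

text \<open>
  The form in which affineness is used: opposite rank-one updates average to the original
  determinant.
\<close>

lemma det_opposite_rank_one_updates:
  fixes t :: "'a::comm_ring_1"
  shows "det (mat m m (\<lambda>(i, j). M i j + - t * x i * y j))
       + det (mat m m (\<lambda>(i, j). M i j + t * x i * y j))
     = 2 * det (mat m m (\<lambda>(i, j). M i j))"
  using det_rank_one_update[of m M "- t" x y] det_rank_one_update[of m M t x y] by simp

theorem theorem3:
  fixes \<iota> :: "rat \<Rightarrow> 'a::comm_ring_1"
    and n :: nat
    and lam \<beta> :: 'a
    and a :: "nat \<Rightarrow> nat \<Rightarrow> 'a"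
  assumes "inj_comm_ring_hom \<iota>"
    and "n \<ge> 1"
    and "\<And>i. 1 < i \<Longrightarrow> i \<le> n \<Longrightarrow> a i 1 = \<beta> * a 1 i"
  shows "det (A_mat n lam a) - \<beta> * (det (B_mat n lam a) + det (C_mat n lam a))
           = (a 1 1 - 2 * \<beta>) * det (labelled_mat 2 n a)"
proof -
  interpret inj_comm_ring_hom \<iota> by fact
  define h where "h = \<iota> (1/2)"
  have half: "h + h = 1"
    unfolding h_def by (simp flip: hom_add)
  have half_twice: "h * z + h * z = z" for z
    using half by (metis distrib_right mult_1)
  obtain m where n: "n = Suc m"
    using assms(2) by (cases n) auto
  define v where "v i = a 1 (2 + i)" for i
  \<comment> \<open>Index \<open>i\<close> here is label \<open>2 + i\<close> in the theorem; the shift by \<open>2\<close> preserves parity.\<close>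
  define d where "d i = (- 1) ^ i * v i" for i
  define M where "M i j = a (2 + i) (2 + j)" for i j
  define N where "N i j = M i j + - (h * lam) * v i * v j" for i j
  define E where "E = det (bordered_mat m 0 v v M)"
  define D where "D = det (mat m m (\<lambda>(i, j). M i j))"
  have lam_half: "lam * v i * v j = h * lam * v i * v j + h * lam * v i * v j" for i j
    using half_twice[of "lam * v i * v j"] by (simp add: mult.assoc)
  have signs: "d i * d j = (if even (i + j) then v i * v j else - (v i * v j))" for i j
  proof -
    have "d i * d j = (- 1) ^ (i + j) * (v i * v j)"
      by (simp add: d_def power_add algebra_simps)
    then show ?thesis by simp
  qed
  have M_mat: "labelled_mat 2 n a = mat m m (\<lambda>(i, j). M i j)"
    by (rule eq_matI) (auto simp: labelled_mat_def n M_def)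
  have v_entry: "a (Suc 0) (Suc (Suc i)) = v i" for i
    by (simp add: v_def)
  have M_entry: "a (Suc (Suc i)) (Suc (Suc j)) = M i j" for i j
    by (simp add: M_def)
  have col_entry: "a (Suc (Suc i)) (Suc 0) = \<beta> * v i" if "i < m" for i
    using assms(3)[of "Suc (Suc i)"] that by (simp add: n v_def)
  have A: "A_mat n lam a = bordered_mat m (a 1 1) (\<lambda>i. \<beta> * v i) (\<lambda>j. lam * v j) M"
    by (rule eq_matI)
      (auto simp: A_mat_def labelled_mat_def bordered_mat_def n v_entry M_entry col_entry
        split: nat.splits)
  have B_entry: "N i j + - (h * lam) * d i * d j
      = (if even (i + j) then M i j - lam * v i * v j else M i j)" for i j
    using signs[of i j] lam_half[of i j] by (simp add: N_def mult.assoc)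
  have C_entry: "N i j + h * lam * d i * d j
      = (if even (i + j) then M i j else M i j - lam * v i * v j)" for i j
    using signs[of i j] lam_half[of i j] by (simp add: N_def mult.assoc)
  have B: "B_mat n lam a = mat m m (\<lambda>(i, j). N i j + - (h * lam) * d i * d j)"
    unfolding B_entry by (rule eq_matI) (simp_all add: B_mat_def labelled_mat_def n v_entry M_entry)
  have C: "C_mat n lam a = mat m m (\<lambda>(i, j). N i j + h * lam * d i * d j)"
    unfolding C_entry by (rule eq_matI) (simp_all add: C_mat_def labelled_mat_def n v_entry M_entry)
  have "det (mat m m (\<lambda>(i, j). N i j)) = D + h * lam * E"
    unfolding N_def D_def E_def using det_rank_one_update[of m M "- (h * lam)" v v] by simp
  then have BC: "det (B_mat n lam a) + det (C_mat n lam a) = 2 * D + lam * E"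
    unfolding B C det_opposite_rank_one_updates
    using half_twice[of "lam * E"] by (simp add: algebra_simps)
  have "det (A_mat n lam a) = a 1 1 * D + lam * \<beta> * E"
    unfolding A D_def E_def by (rule det_bordered_scaled)
  then show ?thesis
    unfolding BC M_mat D_def[symmetric] by (simp add: algebra_simps)
qed

end
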